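(* Let $n$ be a positive integer and let $\sigma=\sigma_1\cdots\sigma_{3n}$ be the output of the right-to-left sweep map applied to a $(2n,n)$-Dyck path $P$. Run the following procedure on $\sigma$, which fills the positions of a sequence $\tau=(\tau_1,\dots,\tau_{3n})$ whose positions are initially empty. - Set $\tau_1=0$. - For $i=2,3,\dots,3n$, if $\tau_i$ is already filled, skip to the next $i$. Otherwise, proceed as follows. - If $\sigma_i=\mathrm{S}$, set $\tau_i=\tau_{i-1}$. - If $\sigma_i=\mathrm{W}$, let $A$ be the number of currently filled positions $j$ with $\tau_j=\tau_{i-1}$. Let $B$ be the number of currently filled positions $j$ with $\tau_j=\tau_{i-1}-2n$ and $\sigma_j=\mathrm{S}$. Put $x=A-B$. - If $x>0$, assign the value $\tau_{i-1}+n$ to the positions $j$ of the first $x$ letters $\mathrm{W}$ of $\sigma$ at positions $j\ge i$, starting with $\sigma_i$. - If $x<0$, assign the value $\tau_{i-1}$ to the positions of the first $|x|$ letters $\mathrm{W}$ of $\sigma$ at positions $j\ge i$. Then the sequence $\tau$ produced is the rank sequence of $P$. That is, for each $j$, $\tau_j$ equals the level of the step of $P$ listed in position $j$ by the right-to-left sweep map.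
   Context: A $(2n,n)$-Dyck path is a sequence of $3n$ steps, $n$ of which are north steps and $2n$ of which are east steps, together with the following levels. Each lattice point of the path has a level: the starting point has level $0$, a north step raises the level by $2n$, an east step lowers the level by $n$. The path is required never to reach a negative level, so it begins and ends at level $0$. The level of a north step is the level of its starting point, called its south endpoint, labelled S. The level of an east step is the level of its starting point, called its west endpoint, labelled W. The right-to-left sweep map lists the $3n$ steps in nondecreasing order of level. Among steps of equal level, the step occurring later in the path is listed first. The output is the word $\sigma=\sigma_1\cdots\sigma_{3n}$ recording S for a north step and W for an east step. The rank sequence of the path is the sequence whose $j$-th entry is the level of the step listed in position $j$. It is the nondecreasing list of all step levels, aligned with $\sigma$. *)

theory Defs
  imports Main
begin

datatype step = North | East

text \<open>A north step is recorded by its south endpoint, an east step by its west endpoint.\<close>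

datatype letter = S | W

primrec letter_of :: "step \<Rightarrow> letter" where
  "letter_of North = S"
| "letter_of East = W"

primrec rise :: "nat \<Rightarrow> step \<Rightarrow> int" where
  "rise n North = 2 * int n"
| "rise n East = - int n"

text \<open>
  \<open>level n P i\<close> is the level of the lattice point reached after \<open>i\<close> steps. With steps
  numbered from 0, this is the starting point of step \<open>P ! i\<close>, so it is also the level of
  that step.
\<close>

definition level :: "nat \<Rightarrow> step list \<Rightarrow> nat \<Rightarrow> int" where
  "level n P i = (\<Sum>s\<leftarrow>take i P. rise n s)"

definition dyck_path :: "nat \<Rightarrow> step list \<Rightarrow> bool" where
  "dyck_path n P \<longleftrightarrow>
     length P = 3 * n \<and> count_list P North = n \<and> count_list P East = 2 * n \<and>
     (\<forall>i \<le> length P. 0 \<le> level n P i)"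

text \<open>
  The indices of the steps in the order in which the right-to-left sweep lists them. Since
  \<^const>\<open>sort_key\<close> is stable, indices of steps of equal level keep the decreasing order they
  have in the reversed index list; lemma \<open>sweep_order_sorted\<close> below confirms this.
\<close>

definition sweep_order :: "nat \<Rightarrow> step list \<Rightarrow> nat list" where
  "sweep_order n P = sort_key (level n P) (rev [0..<length P])"

lemma set_sweep_order: "set (sweep_order n P) = {0..<length P}"
  by (simp add: sweep_order_def)

lemma distinct_sweep_order: "distinct (sweep_order n P)"
  by (simp add: sweep_order_def)

lemma sorted_wrt_insort_key_stable:
  fixes f :: "nat \<Rightarrow> int"
  assumes "sorted_wrt (\<lambda>i j. f i < f j \<or> f i = f j \<and> i > j) xs" "\<forall>y \<in> set xs. y < x"
  shows "sorted_wrt (\<lambda>i j. f i < f j \<or> f i = f j \<and> i > j) (insort_key f x xs)"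
  using assms by (induction xs) (auto simp: set_insort_key)

lemma sweep_order_sorted:
  "sorted_wrt (\<lambda>i j. level n P i < level n P j \<or> level n P i = level n P j \<and> i > j)
     (sweep_order n P)"
proof -
  have "sorted_wrt (\<lambda>i j. f i < f j \<or> f i = f j \<and> i > j) (sort_key f (rev [0..<m]))"
    for f :: "nat \<Rightarrow> int" and m
    by (induction m) (auto intro!: sorted_wrt_insort_key_stable)
  then show ?thesis by (simp add: sweep_order_def)
qed

definition sweep :: "nat \<Rightarrow> step list \<Rightarrow> letter list" where
  "sweep n P = map (\<lambda>i. letter_of (P ! i)) (sweep_order n P)"

definition rank_sequence :: "nat \<Rightarrow> step list \<Rightarrow> int list" where
  "rank_sequence n P = map (level n P) (sweep_order n P)"

text \<open>
  The procedure works on a list \<open>\<tau>\<close> of the same length as \<open>\<sigma>\<close>, in which \<^const>\<open>None\<close> marks an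
  empty position. Positions are numbered from 0, so position \<open>j\<close> here is position \<open>j + 1\<close>
  in one-based numbering.
\<close>

text \<open>The positions of the first \<open>k\<close> letters W of \<open>\<sigma>\<close> from position \<open>i\<close> on (all of them if fewer).\<close>

definition first_Ws :: "letter list \<Rightarrow> nat \<Rightarrow> nat \<Rightarrow> nat list" where
  "first_Ws \<sigma> i k = take k (filter (\<lambda>j. \<sigma> ! j = W) [i..<length \<sigma>])"

definition assign :: "int \<Rightarrow> nat list \<Rightarrow> int option list \<Rightarrow> int option list" where
  "assign v js \<tau> = fold (\<lambda>j t. t[j := Some v]) js \<tau>"

text \<open>
  Two situations in which the procedure has no instruction, namely an empty predecessor of an
  unfilled position and \<open>x = 0\<close>, leave the current position empty. No later iteration
  fills a position before its own, so an empty position passed over in this way stays empty.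
\<close>

definition fill_step :: "nat \<Rightarrow> letter list \<Rightarrow> nat \<Rightarrow> int option list \<Rightarrow> int option list" where
  "fill_step n \<sigma> i \<tau> =
     (if \<tau> ! i \<noteq> None then \<tau>
      else case \<tau> ! (i - 1) of
        None \<Rightarrow> \<tau>
      | Some r \<Rightarrow>
          (case \<sigma> ! i of
             S \<Rightarrow> \<tau>[i := Some r]
           | W \<Rightarrow>
               (let A = card {j. j < length \<sigma> \<and> \<tau> ! j = Some r};
                    B = card {j. j < length \<sigma> \<and> \<tau> ! j = Some (r - 2 * int n) \<and> \<sigma> ! j = S};
                    x = int A - int B
                in if x > 0 then assign (r + int n) (first_Ws \<sigma> i (nat x)) \<tau>
                   else if x < 0 then assign r (first_Ws \<sigma> i (nat \<bar>x\<bar>)) \<tau>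
                   else \<tau>)))"

definition fill_ranks :: "nat \<Rightarrow> letter list \<Rightarrow> int option list" where
  "fill_ranks n \<sigma> =
     fold (fill_step n \<sigma>) [1..<length \<sigma>] ((replicate (length \<sigma>) None)[0 := Some 0])"

end

theory Submission
  imports Defs
begin

text \<open>
  The path is closed, so every level is entered as often as it is left. North steps enter level
  \<open>v\<close> from \<open>v - 2n\<close> and east steps enter it from \<open>v + n\<close>, hence once the levels up to \<open>v\<close>
  are known, the difference \<open>A - B\<close> is the number of east steps at level \<open>v + n\<close>.
  Since the path descends only by \<open>n\<close> at a time, the levels that occur have no gaps, and the
  last step at a positive level is an east step. Thus each block of equal positive ranks begins
  with \<open>W\<close>, and an unfilled \<open>W\<close> always marks the start of the next block; in particular the
  case \<open>x < 0\<close> of the procedure never arises.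
\<close>

section \<open>Filling positions for an abstract rank function\<close>

lemma length_assign [simp]: "length (assign v js \<tau>) = length \<tau>"
  unfolding assign_def by (induction js arbitrary: \<tau>) auto

lemma nth_assign:
  "j < length \<tau> \<Longrightarrow> assign v js \<tau> ! j = (if j \<in> set js then Some v else \<tau> ! j)"
proof (induction js arbitrary: \<tau>)
  case (Cons a js)
  have "assign v (a # js) \<tau> = assign v js (\<tau>[a := Some v])"
    by (simp add: assign_def)
  with Cons show ?case by (auto simp: nth_list_update)
qed (simp add: assign_def)

text \<open>Sortedness makes the elements with key at most \<open>v\<close> a prefix, and
  distinctness makes their number its length. This identifies the positions chosen by
  \<open>first_Ws\<close>.\<close>

lemma set_take_card_le:
  fixes f :: "'a \<Rightarrow> 'b::linorder"
  assumes "sorted (map f xs)" "distinct xs"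
  shows "set (take (card {x \<in> set xs. f x \<le> v}) xs) = {x \<in> set xs. f x \<le> v}"
  using assms
proof (induction xs)
  case (Cons a xs)
  show ?case
  proof (cases "f a \<le> v")
    case True
    then have "{x \<in> set (a # xs). f x \<le> v} = insert a {x \<in> set xs. f x \<le> v}" by auto
    with Cons show ?thesis by simp
  next
    case False
    with Cons.prems have "{x \<in> set (a # xs). f x \<le> v} = {}" by fastforce
    then show ?thesis by (simp only: card.empty take_0 list.set)
  qed
qed simp

text \<open>\<open>state\<close> is the loop invariant: reaching a new block of equal ranks fills
  all its \<open>W\<close>s at once, whereas each \<open>S\<close> waits for its own turn. The path
  enters only through the listed properties of \<open>rk\<close>.\<close>

lemma fill_step_invariant:
  fixes rk :: "nat \<Rightarrow> int"
  defines "state \<sigma> i \<equiv> map (\<lambda>j. if j < i \<or> \<sigma> ! j = W \<and> rk j \<le> rk (i - 1)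
                                then Some (rk j) else None) [0..<length \<sigma>]"
  assumes i: "0 < i" "i < length \<sigma>" and n: "n > 0"
    and mono: "\<And>j k. j \<le> k \<Longrightarrow> k < length \<sigma> \<Longrightarrow> rk j \<le> rk k"
    and S_eq: "\<sigma> ! i = S \<Longrightarrow> rk i = rk (i - 1)"
    and W_next: "\<sigma> ! i = W \<Longrightarrow> rk i \<noteq> rk (i - 1) \<Longrightarrow> rk i = rk (i - 1) + int n"
    and balance: "\<And>v. card {j. j < length \<sigma> \<and> rk j = v} =
        card {j. j < length \<sigma> \<and> rk j = v - 2 * int n \<and> \<sigma> ! j = S} +
        card {j. j < length \<sigma> \<and> rk j = v + int n \<and> \<sigma> ! j = W}"
  shows "fill_step n \<sigma> i (state \<sigma> i) = state \<sigma> (Suc i)"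
proof -
  let ?N = "length \<sigma>"
  define r where "r = rk (i - 1)"
  have len [simp]: "length (state \<sigma> k) = ?N" for k by (simp add: state_def)
  have nth: "state \<sigma> k ! j = (if j < k \<or> \<sigma> ! j = W \<and> rk j \<le> rk (k - 1) then Some (rk j) else None)"
    if "j < ?N" for j k using that by (simp add: state_def)
  have prev: "state \<sigma> i ! (i - 1) = Some r" using i by (simp add: nth r_def)
  have r_le: "r \<le> rk i" unfolding r_def using i by (intro mono) auto
  show ?thesis
  proof (cases "\<sigma> ! i")
    case S
    then have eq: "rk i = r" using S_eq r_def by simp
    have "fill_step n \<sigma> i (state \<sigma> i) = (state \<sigma> i)[i := Some r]"
      using S i nth[of i i] prev by (simp add: fill_step_def)
    also have "\<dots> = state \<sigma> (Suc i)"
      using eq i by (intro nth_equalityI) (auto simp: nth nth_list_update r_def less_Suc_eq)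
    finally show ?thesis .
  next
    case W
    show ?thesis
    proof (cases "rk i = r")
      case True
      then have "fill_step n \<sigma> i (state \<sigma> i) = state \<sigma> i"
        using W i nth[of i i] by (simp add: fill_step_def r_def)
      also have "\<dots> = state \<sigma> (Suc i)"
        using True W by (intro nth_equalityI) (auto simp: nth r_def less_Suc_eq)
      finally show ?thesis .
    next
      case False
      then have rki: "rk i = r + int n" using W W_next r_def by simp
      \<comment> \<open>A new block starts at \<open>i\<close>, so the filled positions are exactly
        those of rank at most \<open>r\<close>, whatever their letter.\<close>
      have before: "j < i \<longleftrightarrow> rk j \<le> r" if "j < ?N" for j
        using mono[of j "i - 1"] mono[of i j] i that rki n unfolding r_def by linarith
      have unfilled: "state \<sigma> i ! i = None" using i rki n by (simp add: nth r_def)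
      define C where "C = {j. j < ?N \<and> rk j = r + int n \<and> \<sigma> ! j = W}"
      \<comment> \<open>Ranks up to \<open>r\<close> are completely recorded, so the counts of the
        procedure are the true ones, and \<open>balance\<close> at \<open>r\<close> gives
        \<open>A - B = card C\<close>.\<close>
      have A: "{j. j < ?N \<and> state \<sigma> i ! j = Some r} = {j. j < ?N \<and> rk j = r}"
        using before by (auto simp: nth r_def split: if_splits)
      have B: "{j. j < ?N \<and> state \<sigma> i ! j = Some (r - 2 * int n) \<and> \<sigma> ! j = S} =
               {j. j < ?N \<and> rk j = r - 2 * int n \<and> \<sigma> ! j = S}"
        using before by (auto simp: nth r_def split: if_splits)
      have "i \<in> C" "finite C" using i W rki by (auto simp: C_def)
      then have pos: "card C > 0" by (auto simp: card_gt_0_iff)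
      have "fill_step n \<sigma> i (state \<sigma> i) = assign (r + int n) (first_Ws \<sigma> i (card C)) (state \<sigma> i)"
        using W unfilled prev pos unfolding fill_step_def
        by (simp add: A B balance[of r] Let_def flip: C_def)
      moreover have "set (first_Ws \<sigma> i (card C)) = C"
      proof -
        let ?L = "filter (\<lambda>j. \<sigma> ! j = W) [i..<?N]"
        have "sorted_wrt (\<lambda>j k. rk j \<le> rk k) [i..<?N]"
          by (rule sorted_wrt_mono_rel[OF _ sorted_upt]) (auto intro: mono)
        then have "sorted (map rk ?L)" by (simp add: sorted_map sorted_wrt_filter)
        \<comment> \<open>Earlier positions have rank at most \<open>r\<close>, and from
          \<open>i\<close> on ranks are at least \<open>r + int n\<close>; the upper bound thus
          selects this block.\<close>
        moreover have "C = {j \<in> set ?L. rk j \<le> r + int n}"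
          using mono[of i] rki before i n by (force simp: C_def not_less intro: antisym)
        ultimately show ?thesis
          using set_take_card_le[of rk ?L "r + int n"] by (simp add: first_Ws_def)
      qed
      moreover have "assign (r + int n) js (state \<sigma> i) = state \<sigma> (Suc i)" if "set js = C" for js
      proof (rule nth_equalityI)
        fix j assume "j < length (assign (r + int n) js (state \<sigma> i))"
        then have j: "j < ?N" by simp
        \<comment> \<open>The invariant at \<open>Suc i\<close> compares with \<open>rk i\<close>.
          Among positions from \<open>i\<close> on, being at most \<open>rk i\<close> forces
          equality, so only \<open>C\<close> is added.\<close>
        have "rk j = r + int n" if "\<not> j < i" "rk j \<le> rk i"
          using mono[of i j] that j rki by simp
        then show "assign (r + int n) js (state \<sigma> i) ! j = state \<sigma> (Suc i) ! j"
          using j \<open>set js = C\<close> rki before[OF j] W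
          by (auto simp: nth_assign nth C_def r_def less_Suc_eq)
      qed simp
      ultimately show ?thesis by simp
    qed
  qed
qed

text \<open>At index 1 the invariant is the initial list; at index \<open>length \<sigma>\<close> it
  says that every position holds its rank.\<close>

lemma fill_ranks_eq:
  fixes rk :: "nat \<Rightarrow> int"
  assumes n: "n > 0"
    and mono: "\<And>j k. j \<le> k \<Longrightarrow> k < length \<sigma> \<Longrightarrow> rk j \<le> rk k"
    and rk_0: "rk 0 = 0"
    and W_pos: "\<And>j. j < length \<sigma> \<Longrightarrow> \<sigma> ! j = W \<Longrightarrow> rk j > 0"
    and S_eq: "\<And>i. 0 < i \<Longrightarrow> i < length \<sigma> \<Longrightarrow> \<sigma> ! i = S \<Longrightarrow> rk i = rk (i - 1)"
    and W_next: "\<And>i. 0 < i \<Longrightarrow> i < length \<sigma> \<Longrightarrow> \<sigma> ! i = W \<Longrightarrow> rk i \<noteq> rk (i - 1) \<Longrightarrow>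
        rk i = rk (i - 1) + int n"
    and balance: "\<And>v. card {j. j < length \<sigma> \<and> rk j = v} =
        card {j. j < length \<sigma> \<and> rk j = v - 2 * int n \<and> \<sigma> ! j = S} +
        card {j. j < length \<sigma> \<and> rk j = v + int n \<and> \<sigma> ! j = W}"
  shows "fill_ranks n \<sigma> = map (\<lambda>j. Some (rk j)) [0..<length \<sigma>]"
proof (cases "\<sigma> = []")
  case False
  define state where "state i = map (\<lambda>j. if j < i \<or> \<sigma> ! j = W \<and> rk j \<le> rk (i - 1)
      then Some (rk j) else None) [0..<length \<sigma>]" for i
  \<comment> \<open>Beyond position 0 the invariant would fill only a \<open>W\<close> of rank at
    most \<open>rk 0 = 0\<close>, which \<open>W_pos\<close> excludes.\<close>
  have init: "(replicate (length \<sigma>) None)[0 := Some 0] = state 1"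
    using W_pos rk_0 by (intro nth_equalityI) (force simp: state_def nth_list_update)+
  have "fold (fill_step n \<sigma>) [1..<Suc k] (state 1) = state (Suc k)" if "Suc k \<le> length \<sigma>" for k
    using that
  proof (induction k)
    case (Suc k)
    have "fill_step n \<sigma> (Suc k) (state (Suc k)) = state (Suc (Suc k))"
      unfolding state_def
      by (rule fill_step_invariant) (use Suc.prems S_eq[of "Suc k"] W_next[of "Suc k"] in \<open>auto intro: n mono balance\<close>)
    with Suc show ?case by simp
  qed simp
  from this[of "length \<sigma> - 1"] False show ?thesis
    by (simp add: fill_ranks_def init[unfolded One_nat_def]) (simp add: state_def)
qed (simp add: fill_ranks_def)

section \<open>Levels along a Dyck path\<close>

lemma level_0 [simp]: "level n P 0 = 0"
  by (simp add: level_def)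

lemma level_Suc: "i < length P \<Longrightarrow> level n P (Suc i) = level n P i + rise n (P ! i)"
  by (simp add: level_def take_Suc_conv_app_nth)

lemma dvd_level: "int n dvd level n P i"
proof -
  have "int n dvd rise n s" for s by (cases s) auto
  then have "int n dvd (\<Sum>s\<leftarrow>xs. rise n s)" for xs by (induction xs) auto
  then show ?thesis by (simp add: level_def)
qed

lemma sum_rise:
  "(\<Sum>s\<leftarrow>P. rise n s) = 2 * int n * int (count_list P North) - int n * int (count_list P East)"
proof (induction P)
  case (Cons s P)
  then show ?case by (cases s) (auto simp: algebra_simps)
qed simp

lemma level_length: "dyck_path n P \<Longrightarrow> level n P (length P) = 0"
  by (simp add: dyck_path_def level_def sum_rise)

text \<open>Take the last lattice point of level at least \<open>v\<close>. The path ends at 0,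
  below \<open>v\<close>, so a step follows; it drops by at most \<open>n\<close>, and divisibility
  by \<open>n\<close> leaves only the level \<open>v\<close> itself.\<close>

lemma level_descends:
  assumes P: "dyck_path n P" and n: "n > 0" and a: "a \<le> length P" "level n P a \<ge> v"
    and v: "int n dvd v" "v > 0"
  obtains b where "a \<le> b" "b < length P" "level n P b = v"
proof -
  let ?Q = "\<lambda>b. b \<le> length P \<and> v \<le> level n P b"
  define b where "b = Greatest ?Q"
  have Qb: "?Q b" unfolding b_def by (rule GreatestI_nat[of ?Q a "length P"]) (use a in auto)
  have le: "c \<le> b" if "?Q c" for c
    unfolding b_def by (rule Greatest_le_nat[of ?Q c "length P"]) (use that in auto)
  have b: "b < length P" using Qb v level_length[OF P] by (cases "b = length P") auto
  then have "level n P (Suc b) < v" using le[of "Suc b"] by fastforce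
  moreover have "rise n s \<ge> - int n" for s by (cases s) auto
  ultimately have lt: "level n P b - v < int n"
    using level_Suc[OF b, of n] by (smt (verit))
  have "int n dvd level n P b - v" using v dvd_level by simp
  then have "level n P b = v" using lt Qb zdvd_not_zless[of "level n P b - v" "int n"] by linarith
  with b le a show thesis by (intro that[of b]) auto
qed

text \<open>Visits to level \<open>v\<close> are counted once by the steps starting there and once
  by the steps ending there, the latter split by direction.\<close>

lemma card_level_balance:
  assumes "dyck_path n P"
  shows "card {i. i < length P \<and> level n P i = v} =
    card {i. i < length P \<and> level n P i = v - 2 * int n \<and> P ! i = North} +
    card {i. i < length P \<and> level n P i = v + int n \<and> P ! i = East}"
proof -
  let ?N = "length P"
  let ?D = "{i. i < ?N \<and> level n P (Suc i) = v}"
  \<comment> \<open>\<open>E\<close> includes both endpoints of the path. Dropping the last point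
    leaves starts of steps, dropping the first leaves ends of steps; both points have level 0, so
    the cardinality is the same.\<close>
  define E where "E = {i. i \<le> ?N \<and> level n P i = v}"
  have "finite E" by (simp add: E_def)
  have "card {i. i < ?N \<and> level n P i = v} = card (E - {?N})"
    by (rule arg_cong[where f = card]) (auto simp: E_def)
  also have "\<dots> = card (E - {0})"
    using level_length[OF assms] \<open>finite E\<close> by (auto simp: card_Diff_singleton_if E_def)
  also have "E - {0} = Suc ` ?D"
  proof (rule set_eqI)
    show "i \<in> E - {0} \<longleftrightarrow> i \<in> Suc ` ?D" for i
      by (cases i) (auto simp: E_def Suc_le_eq)
  qed
  also have "card \<dots> = card ?D" by (simp add: card_image)
  also have "?D = {i. i < ?N \<and> level n P i = v - 2 * int n \<and> P ! i = North} \<union>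
                  {i. i < ?N \<and> level n P i = v + int n \<and> P ! i = East}" (is "_ = ?L \<union> ?R")
  proof (rule set_eqI)
    show "i \<in> ?D \<longleftrightarrow> i \<in> ?L \<union> ?R" for i
      by (cases "P ! i") (auto simp: level_Suc)
  qed
  also have "card \<dots> = card ?L + card ?R" by (intro card_Un_disjoint) auto
  finally show ?thesis .
qed

section \<open>The sweep order and its blocks of equal rank\<close>

lemma letter_of_eq_iff: "letter_of s = S \<longleftrightarrow> s = North" "letter_of s = W \<longleftrightarrow> s = East"
  by (cases s; simp)+

lemma length_sweep_order [simp]: "length (sweep_order n P) = length P"
  by (simp add: sweep_order_def)

lemma card_sweep_order:
  "card {j. j < length P \<and> Q (sweep_order n P ! j)} = card {i. i < length P \<and> Q i}"
proof -
  have bij: "bij_betw ((!) (sweep_order n P)) {..<length P} {0..<length P}"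
    by (rule bij_betw_nth) (simp_all add: distinct_sweep_order set_sweep_order)
  have "bij_betw ((!) (sweep_order n P)) {j \<in> {..<length P}. Q (sweep_order n P ! j)}
          {i \<in> {0..<length P}. Q i}"
    using bij by (auto simp: bij_betw_def intro: inj_on_subset)
  from bij_betw_same_card[OF this] show ?thesis by simp
qed

text \<open>Step \<open>b\<close> must be listed somewhere, but the hypotheses place it strictly
  between adjacent positions. The tie in \<open>before\<close> reflects that later steps of equal
  level come first.\<close>

lemma sweep_order_no_gap:
  fixes n :: nat and P :: "step list"
  defines "ord \<equiv> sweep_order n P"
  assumes i: "0 < i" "i < length P" and b: "b < length P"
    and after: "level n P (ord ! (i - 1)) < level n P b"
    and before: "level n P b < level n P (ord ! i) \<or> level n P b = level n P (ord ! i) \<and> b > ord ! i"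
  shows False
proof -
  obtain k where k: "k < length P" "ord ! k = b"
    using b set_sweep_order[of n P] by (auto simp: in_set_conv_nth ord_def set_eq_iff)
  have srt: "level n P (ord ! j) < level n P (ord ! k) \<or>
      level n P (ord ! j) = level n P (ord ! k) \<and> ord ! j > ord ! k" if "j < k" "k < length P" for j k
    using sorted_wrt_nth_less[OF sweep_order_sorted, of j k n P] that by (simp add: ord_def)
  from k after have "\<not> k \<le> i - 1"
    using srt[of k "i - 1"] i by (cases "k = i - 1") force+
  moreover from k before have "\<not> i \<le> k"
    using srt[of i k] by (cases "k = i") force+
  ultimately show False by simp
qed

theorem theorem3p3:
  fixes n :: nat and P :: "step list" and \<sigma> :: "letter list"
  assumes "n > 0"
    and "dyck_path n P"
    and "\<sigma> = sweep n P"
  shows "fill_ranks n \<sigma> = map Some (rank_sequence n P)"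
proof -
  define ord where "ord = sweep_order n P"
  define rk where "rk j = level n P (ord ! j)" for j
  have len: "length \<sigma> = length P" by (simp add: assms sweep_def)
  have \<sigma>_nth: "\<sigma> ! j = letter_of (P ! (ord ! j))" if "j < length P" for j
    using that by (simp add: assms sweep_def ord_def)
  have ord_less: "ord ! j < length P" if "j < length P" for j
    using that nth_mem[of j ord] set_sweep_order[of n P] by (simp add: ord_def)
  have nonneg: "level n P i \<ge> 0" if "i \<le> length P" for i
    using assms(2) that by (simp add: dyck_path_def)
  have mono: "rk j \<le> rk k" if "j \<le> k" "k < length P" for j k
    using sorted_wrt_nth_less[OF sweep_order_sorted, of j k n P] that
    by (cases "j = k") (auto simp: rk_def ord_def)
  have "fill_ranks n \<sigma> = map (\<lambda>j. Some (rk j)) [0..<length \<sigma>]"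
  proof (rule fill_ranks_eq)
    show "n > 0" by fact
    show "rk j \<le> rk k" if "j \<le> k" "k < length \<sigma>" for j k using mono that len by simp
    \<comment> \<open>The first step of the path has level 0, which bounds the least rank from
      above.\<close>
    have "length P > 0" using assms(1,2) by (simp add: dyck_path_def)
    moreover from this obtain k where "k < length P" "ord ! k = 0"
      using set_sweep_order[of n P] by (auto simp: in_set_conv_nth ord_def set_eq_iff)
    ultimately show "rk 0 = 0"
      using mono[of 0 k] nonneg[of "ord ! 0"] ord_less[of 0] by (simp add: rk_def)
    show "rk j > 0" if j: "j < length \<sigma>" "\<sigma> ! j = W" for j
    proof -
      have "P ! (ord ! j) = East" using j \<sigma>_nth len by (simp add: letter_of_eq_iff)
      then show ?thesis
        using level_Suc[of "ord ! j" P n] ord_less[of j] nonneg[of "Suc (ord ! j)"] j len assms(1)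
        by (simp add: rk_def)
    qed
    show "rk i = rk (i - 1)" if i: "0 < i" "i < length \<sigma>" "\<sigma> ! i = S" for i
    proof (rule ccontr)
      assume "rk i \<noteq> rk (i - 1)"
      with mono[of "i - 1" i] i len have gt: "rk (i - 1) < rk i" by simp
      have "P ! (ord ! i) = North" using i \<sigma>_nth len by (simp add: letter_of_eq_iff)
      then have "rk i \<le> level n P (Suc (ord ! i))"
        using level_Suc[of "ord ! i" P n] ord_less[of i] i len by (simp add: rk_def)
      moreover have "rk i > 0"
        using gt nonneg[of "ord ! (i - 1)"] ord_less[of "i - 1"] i len unfolding rk_def by linarith
      \<comment> \<open>After the north step the path must come back to the positive level
        \<open>rk i\<close>. The step \<open>b\<close> found there is later in the path, hence due
        before position \<open>i\<close>, yet after \<open>i - 1\<close>.\<close>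
      ultimately obtain b where "Suc (ord ! i) \<le> b" "b < length P" "level n P b = rk i"
        using level_descends[OF assms(2,1), of "Suc (ord ! i)" "rk i"] ord_less[of i] i len
        by (auto simp: rk_def dvd_level)
      with sweep_order_no_gap[of i P b n] gt i len show False
        by (simp add: rk_def ord_def)
    qed
    show "rk i = rk (i - 1) + int n"
      if i: "0 < i" "i < length \<sigma>" and "rk i \<noteq> rk (i - 1)" for i
    proof (rule ccontr)
      assume neq: "rk i \<noteq> rk (i - 1) + int n"
      have "rk (i - 1) < rk i" using mono[of "i - 1" i] i that len by simp
      moreover have "int n dvd rk i - rk (i - 1)" by (simp add: rk_def dvd_level)
      ultimately have gt: "rk (i - 1) + int n < rk i"
        using neq zdvd_imp_le[of "int n" "rk i - rk (i - 1)"] by simp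
      have "rk (i - 1) \<ge> 0"
        using nonneg[of "ord ! (i - 1)"] ord_less[of "i - 1"] i len unfolding rk_def by linarith
      \<comment> \<open>Descending from level \<open>rk i\<close>, the path meets the skipped level,
        and a step there would be listed between \<open>i - 1\<close> and \<open>i\<close>.\<close>
      then obtain b where "b < length P" "level n P b = rk (i - 1) + int n"
        using level_descends[OF assms(2,1), of "ord ! i" "rk (i - 1) + int n"] gt
          ord_less[of i] i len assms(1)
        by (auto simp: rk_def dvd_level)
      with sweep_order_no_gap[of i P b n] gt i len assms(1) show False
        by (simp add: rk_def ord_def)
    qed
    show "card {j. j < length \<sigma> \<and> rk j = v} =
        card {j. j < length \<sigma> \<and> rk j = v - 2 * int n \<and> \<sigma> ! j = S} +
        card {j. j < length \<sigma> \<and> rk j = v + int n \<and> \<sigma> ! j = W}" for v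
      using card_level_balance[OF assms(2), of v]
        card_sweep_order[of P "\<lambda>i. level n P i = v" n]
        card_sweep_order[of P "\<lambda>i. level n P i = v - 2 * int n \<and> P ! i = North" n]
        card_sweep_order[of P "\<lambda>i. level n P i = v + int n \<and> P ! i = East" n]
      by (simp add: len rk_def \<sigma>_nth letter_of_eq_iff ord_def cong: conj_cong)
  qed
  also have "\<dots> = map Some (rank_sequence n P)"
    by (rule nth_equalityI) (simp_all add: len rank_sequence_def rk_def ord_def)
  finally show ?thesis .
qed

end
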